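(* Let $s$ be an even integer, let $t$ be any integer, and let $n$ be a non-negative integer. Then $$\sum_{k=0}^n \binom{n}{k} \frac{1}{(k+1)(k+2)} (-1)^{k} L_s^{n-k} F_{s(n+k+4)+t} = -\frac{1}{(n+1)(n+2)}\Big( L_s^{n+1} F_{s(n+1)+t} - F_t \Big) + \frac{1}{n+2} L_s^{n+1} F_{s(n+3)+t}$$ and $$\sum_{k=0}^n \binom{n}{k} \frac{1}{(k+1)(k+2)} (-1)^{k} L_s^{n-k} L_{s(n+k+4)+t} = -\frac{1}{(n+1)(n+2)}\Big( L_s^{n+1} L_{s(n+1)+t} - L_t \Big) + \frac{1}{n+2} L_s^{n+1} L_{s(n+3)+t}.$$
   Context: $F_m$ and $L_m$ denote the Fibonacci and Lucas numbers, defined for all integers $m$ by the recurrence $x_m = x_{m-1}+x_{m-2}$ with $F_0=0$, $F_1=1$ and $L_0=2$, $L_1=1$. In particular $F_{-m}=(-1)^{m-1}F_m$ and $L_{-m}=(-1)^m L_m$. *)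

theory Defs
  imports Complex_Main "HOL-Number_Theory.Fib"
begin

text \<open>
  Two-sided Fibonacci and Lucas numbers. For negative indices the recurrence
  \<open>x m = x (m - 1) + x (m - 2)\<close> is solved for its last term;
  the lemmas below show that it then holds at every integer.
\<close>

function fib_int :: "int \<Rightarrow> int" where
  "fib_int m =
    (if m = 0 then 0
     else if m = 1 then 1
     else if m > 1 then fib_int (m - 1) + fib_int (m - 2)
     else fib_int (m + 2) - fib_int (m + 1))"
  by pat_completeness auto
termination
  by (relation "measure (\<lambda>m. nat (if m \<ge> 0 then m else 2 - m))") auto

function lucas_int :: "int \<Rightarrow> int" where
  "lucas_int m =
    (if m = 0 then 2
     else if m = 1 then 1
     else if m > 1 then lucas_int (m - 1) + lucas_int (m - 2)
     else lucas_int (m + 2) - lucas_int (m + 1))"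
  by pat_completeness auto
termination
  by (relation "measure (\<lambda>m. nat (if m \<ge> 0 then m else 2 - m))") auto

declare fib_int.simps [simp del] lucas_int.simps [simp del]

lemma fib_int_0 [simp]: "fib_int 0 = 0"
  and fib_int_1 [simp]: "fib_int 1 = 1"
  by (simp_all add: fib_int.simps)

lemma lucas_int_0 [simp]: "lucas_int 0 = 2"
  and lucas_int_1 [simp]: "lucas_int 1 = 1"
  by (simp_all add: lucas_int.simps)

lemma fib_int_rec: "fib_int m = fib_int (m - 1) + fib_int (m - 2)"
proof (cases "m > 1")
  case True
  then show ?thesis by (subst fib_int.simps) simp
next
  case False
  then have "fib_int (m - 2) = fib_int m - fib_int (m - 1)"
    by (subst fib_int.simps) simp
  then show ?thesis by simp
qed

lemma lucas_int_rec: "lucas_int m = lucas_int (m - 1) + lucas_int (m - 2)"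
proof (cases "m > 1")
  case True
  then show ?thesis by (subst lucas_int.simps) simp
next
  case False
  then have "lucas_int (m - 2) = lucas_int m - lucas_int (m - 1)"
    by (subst lucas_int.simps) simp
  then show ?thesis by simp
qed

lemma fib_int_of_nat: "fib_int (int n) = int (fib n)"
proof (induction n rule: fib.induct)
  case (3 n)
  then show ?case
    by (subst fib_int_rec) (simp add: algebra_simps)
qed simp_all

lemma fib_int_minus_of_nat: "fib_int (- int n) = (-1) ^ (n + 1) * fib_int (int n)"
proof (induction n rule: fib.induct)
  case 2
  then show ?case using fib_int_rec [of 1] by simp
next
  case (3 n)
  then show ?case
    using fib_int_rec [of "- int n"] fib_int_rec [of "int n + 2"]
    by (simp add: algebra_simps minus_diff_commute [of 1])
qed simp_all

lemma lucas_int_minus_of_nat: "lucas_int (- int n) = (-1) ^ n * lucas_int (int n)"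
proof (induction n rule: fib.induct)
  case 2
  then show ?case using lucas_int_rec [of 1] by simp
next
  case (3 n)
  then show ?case
    using lucas_int_rec [of "- int n"] lucas_int_rec [of "int n + 2"]
    by (simp add: algebra_simps minus_diff_commute [of 1])
qed simp_all

end

theory Submission
  imports Defs
begin

text \<open>
  The binomial weights satisfy
  \<open>(n choose k) / ((k + 1) (k + 2)) = (n + 2 choose k + 2) / ((n + 1) (n + 2))\<close>,
  so both sums are tails, lacking the first two terms, of
  \<open>\<Sum>j\<le>N. (N choose j) (-1)^j L^(N - j) h (N + j)\<close> with \<open>N = n + 2\<close>
  and \<open>h m = F (s m + t)\<close> or \<open>L (s m + t)\<close>. Since \<open>s\<close> is even, \<open>h\<close> satisfies
  \<open>h (m + 2) = L h (m + 1) - h m\<close> with \<open>L = L_s\<close>; for a power \<open>h m = x^m\<close> this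
  says \<open>x (L - x) = 1\<close>, so the full sum is \<open>(x (L - x))^N = 1 = h 0\<close>.
\<close>

text \<open>For fixed \<open>m\<close>, both sides satisfy the Fibonacci recurrence in
  \<open>k\<close>: the factor \<open>(-1) ^ k\<close> compensates for running \<open>G\<close>
  backwards. Agreement at \<open>k = 0\<close> and \<open>k = 1\<close> then suffices.\<close>

lemma lucas_int_times_nat:
  fixes G :: "int \<Rightarrow> int"
  assumes G: "\<And>m. G m = G (m - 1) + G (m - 2)"
  shows "lucas_int (int k) * G m = G (m + int k) + (-1) ^ k * G (m - int k)"
proof (induction k rule: fib.induct)
  case 2
  then show ?case using G [of "m + 1"] by simp
next
  case (3 k)
  have "lucas_int (int (Suc (Suc k))) = lucas_int (int (Suc k)) + lucas_int (int k)"
    using lucas_int_rec [of "int k + 2"] by (simp add: algebra_simps)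
  moreover have "G (m + int (Suc (Suc k))) = G (m + int (Suc k)) + G (m + int k)"
    using G [of "m + int k + 2"] by (simp add: algebra_simps)
  moreover have "G (m - int k) = G (m - int (Suc k)) + G (m - int (Suc (Suc k)))"
    using G [of "m - int k"] by (simp add: algebra_simps)
  ultimately show ?case using 3 by (simp add: algebra_simps)
qed simp

text \<open>For even \<open>s\<close> the sign is 1 and both sides are invariant under
  \<open>s\<close> to \<open>-s\<close>, so the natural-number case covers negative \<open>s\<close>
  too.\<close>

lemma lucas_int_times_even:
  fixes G :: "int \<Rightarrow> int"
  assumes G: "\<And>m. G m = G (m - 1) + G (m - 2)" and s: "even s"
  shows "lucas_int s * G m = G (m + s) + G (m - s)"
proof (cases s rule: int_cases2)
  case (nonneg k)
  then show ?thesis using s lucas_int_times_nat [OF G, of k m] by simp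
next
  case (nonpos k)
  then show ?thesis
    using s lucas_int_times_nat [OF G, of k m] by (simp add: lucas_int_minus_of_nat)
qed

lemma binomial_sum_recurrence:
  fixes h :: "nat \<Rightarrow> 'a::comm_ring_1"
  assumes h: "\<And>m. h (m + 2) = L * h (m + 1) - h m"
  shows "(\<Sum>j\<le>N. of_nat (N choose j) * (-1) ^ j * L ^ (N - j) * h (m + N + j)) = h m"
proof (induction N arbitrary: m)
  case (Suc N)
  let ?S = "\<lambda>N m. \<Sum>j\<le>N. of_nat (N choose j) * (-1) ^ j * L ^ (N - j) * h (m + N + j)"
  let ?f = "\<lambda>j. of_nat (N choose j) * (-1) ^ j * L ^ (Suc N - j) * h (m + Suc N + j)"
  \<comment> \<open>Pascal's rule splits the term at \<open>Suc j\<close>; the part with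
    \<open>N choose j\<close> has its sign flipped and its index raised by 2.\<close>
  have "?S (Suc N) m = ?f 0 + (\<Sum>j\<le>N. ?f (Suc j) - of_nat (N choose j) * (-1) ^ j
      * L ^ (N - j) * h (m + 2 + N + j))"
    unfolding sum.atMost_Suc_shift
    by (intro arg_cong2 [where f = "(+)"] sum.cong refl) (simp_all add: algebra_simps)
  also have "\<dots> = (\<Sum>j\<le>Suc N. ?f j) - ?S N (m + 2)"
    by (subst sum.atMost_Suc_shift) (simp add: sum_subtractf)
  \<comment> \<open>The last term vanishes because \<open>N choose Suc N = 0\<close>; every other
    term has a spare factor \<open>L\<close>.\<close>
  also have "(\<Sum>j\<le>Suc N. ?f j) = L * ?S N (m + 1)"
    by (simp add: sum_distrib_left Suc_diff_le binomial_eq_0 algebra_simps)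
  also have "L * ?S N (m + 1) - ?S N (m + 2) = h m"
    unfolding Suc.IH by (simp add: h [of m, simplified])
  finally show ?case .
qed simp

text \<open>The absorption identity
  \<open>(n + 1) (n choose k) = (k + 1) (n + 1 choose k + 1)\<close>, applied twice.\<close>

lemma binomial_divide_succ_succ:
  "real (n choose k) * (1 / ((real k + 1) * (real k + 2)))
    = real (Suc (Suc n) choose Suc (Suc k)) / ((real n + 1) * (real n + 2))"
proof -
  have "(real n + 1) * real (n choose k) = real (Suc n choose Suc k) * (real k + 1)"
    using arg_cong [OF Suc_times_binomial_eq [of n k], of real] by (simp add: algebra_simps)
  moreover have "(real n + 2) * real (Suc n choose Suc k)
      = real (Suc (Suc n) choose Suc (Suc k)) * (real k + 2)"
    using arg_cong [OF Suc_times_binomial_eq [of "Suc n" "Suc k"], of real]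
    by (simp add: algebra_simps del: binomial_Suc_Suc)
  ultimately have "(real n + 2) * ((real n + 1) * real (n choose k))
      = real (Suc (Suc n) choose Suc (Suc k)) * (real k + 2) * (real k + 1)"
    by (metis mult.assoc)
  then show ?thesis by (simp add: divide_simps mult_ac del: binomial_Suc_Suc)
qed

lemma binomial_sum_weighted:
  fixes h :: "nat \<Rightarrow> real"
  assumes h: "\<And>m. h (m + 2) = L * h (m + 1) - h m"
  shows "(\<Sum>k=0..n. real (n choose k) * (1 / ((real k + 1) * (real k + 2))) * (-1) ^ k
        * L ^ (n - k) * h (n + k + 4))
      = - (1 / ((real n + 1) * (real n + 2))) * (L ^ (n + 1) * h (n + 1) - h 0)
        + 1 / (real n + 2) * L ^ (n + 1) * h (n + 3)"
    (is "?lhs = ?rhs")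
proof -
  let ?D = "(real n + 1) * (real n + 2)"
  let ?g = "\<lambda>j. real (Suc (Suc n) choose j) * (-1) ^ j * L ^ (Suc (Suc n) - j)
    * h (0 + Suc (Suc n) + j)"
  have nz: "real n + 1 \<noteq> 0" "real n + 2 \<noteq> 0"
    by linarith+
  have clear_denominators: "a * b * (- (1 / (a * b)) * x + 1 / b * y * z) = a * y * z - x"
    if "a \<noteq> 0" "b \<noteq> 0" for a b x y z :: real
    using that by (simp add: field_simps)
  have "?lhs = (\<Sum>k\<le>n. ?g (Suc (Suc k)) / ?D)"
    unfolding binomial_divide_succ_succ atLeast0AtMost
    by (intro sum.cong refl) (simp add: numeral_eq_Suc del: binomial_Suc_Suc)
  then have "?D * ?lhs = (\<Sum>k\<le>n. ?g (Suc (Suc k)))"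
    by (simp add: sum_divide_distrib [symmetric] del: binomial_Suc_Suc)
  also have "\<dots> = (\<Sum>j\<le>Suc (Suc n). ?g j) - ?g 0 - ?g (Suc 0)"
    by (simp only: sum.atMost_Suc_shift)
  also have "(\<Sum>j\<le>Suc (Suc n). ?g j) = h 0"
    by (rule binomial_sum_recurrence [OF h])
  \<comment> \<open>One factor of \<open>L ^ (n + 2)\<close> is spent on
    \<open>L * h (n + 2) = h (n + 3) + h (n + 1)\<close>.\<close>
  also have "?g 0 = L ^ (n + 1) * (h (n + 3) + h (n + 1))"
    using h [of "n + 1"] by (simp add: numeral_eq_Suc)
  also have "?g (Suc 0) = - (real n + 2) * L ^ (n + 1) * h (n + 3)"
    by (simp add: numeral_eq_Suc algebra_simps)
  \<comment> \<open>The coefficient of \<open>L ^ (n + 1) * h (n + 3)\<close> is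
    \<open>(n + 2) - 1 = n + 1\<close>, which cancels against \<open>?D\<close> to leave
    \<open>1 / (n + 2)\<close>.\<close>
  also have "h 0 - L ^ (n + 1) * (h (n + 3) + h (n + 1)) - - (real n + 2) * L ^ (n + 1) * h (n + 3)
      = ?D * ?rhs"
    unfolding clear_denominators [OF nz] by (simp add: algebra_simps)
  finally show ?thesis
    using nz by simp
qed

text \<open>Stated for an arbitrary solution \<open>G\<close> of the recurrence, so that the
  Fibonacci and Lucas identities are two instances.\<close>

lemma binomial_sum_fibonacci_type:
  fixes G :: "int \<Rightarrow> int" and s t :: int
  assumes G: "\<And>m. G m = G (m - 1) + G (m - 2)" and s: "even s"
  shows "(\<Sum>k=0..n. real (n choose k) * (1 / ((real k + 1) * (real k + 2))) * (-1) ^ k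
        * real_of_int (lucas_int s) ^ (n - k)
        * real_of_int (G (s * (int n + int k + 4) + t)))
      = - (1 / ((real n + 1) * (real n + 2)))
          * (real_of_int (lucas_int s) ^ (n + 1) * real_of_int (G (s * (int n + 1) + t))
             - real_of_int (G t))
        + 1 / (real n + 2) * real_of_int (lucas_int s) ^ (n + 1)
          * real_of_int (G (s * (int n + 3) + t))"
proof -
  define h where "h m = real_of_int (G (s * int m + t))" for m
  have "h (m + 2) = real_of_int (lucas_int s) * h (m + 1) - h m" for m
  proof -
    have "lucas_int s * G (s * int (m + 1) + t) = G (s * int (m + 2) + t) + G (s * int m + t)"
      using lucas_int_times_even [OF G s, of "s * int (m + 1) + t"] by (simp add: algebra_simps)
    then show ?thesis unfolding h_def of_int_mult [symmetric] by simp
  qed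
  from binomial_sum_weighted [OF this, of n] show ?thesis
    by (simp add: h_def ac_simps)
qed

theorem theorem15:
  fixes s t :: int and n :: nat
  assumes "even s"
  shows
    "((\<Sum>k=0..n. real (n choose k) * (1 / ((real k + 1) * (real k + 2))) * (-1) ^ k
        * real_of_int (lucas_int s) ^ (n - k)
        * real_of_int (fib_int (s * (int n + int k + 4) + t)))
      = - (1 / ((real n + 1) * (real n + 2)))
          * (real_of_int (lucas_int s) ^ (n + 1) * real_of_int (fib_int (s * (int n + 1) + t))
             - real_of_int (fib_int t))
        + 1 / (real n + 2) * real_of_int (lucas_int s) ^ (n + 1)
          * real_of_int (fib_int (s * (int n + 3) + t)))
      \<and>
    ((\<Sum>k=0..n. real (n choose k) * (1 / ((real k + 1) * (real k + 2))) * (-1) ^ k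
        * real_of_int (lucas_int s) ^ (n - k)
        * real_of_int (lucas_int (s * (int n + int k + 4) + t)))
      = - (1 / ((real n + 1) * (real n + 2)))
          * (real_of_int (lucas_int s) ^ (n + 1) * real_of_int (lucas_int (s * (int n + 1) + t))
             - real_of_int (lucas_int t))
        + 1 / (real n + 2) * real_of_int (lucas_int s) ^ (n + 1)
          * real_of_int (lucas_int (s * (int n + 3) + t)))"
  using binomial_sum_fibonacci_type [OF fib_int_rec assms]
    binomial_sum_fibonacci_type [OF lucas_int_rec assms]
  by blast

end
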